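(* Let $\mathcal{F}=(G,\Gamma,p,\pi)$ be a periodic framework in $\mathbb{R}^d$, and let $T:\mathbb{R}^d\to\mathbb{R}^d$ be an invertible affine transformation with linear part $A$. Then the infinitesimal auxetic cone is preserved under $T$: the natural isomorphism $$(\dot p_i,\dot\Lambda)\mapsto\left((A^t)^{-1}\dot p_i,\ (A^t)^{-1}\dot\Lambda\right)$$ from the vector space of infinitesimal deformations of $\mathcal{F}$ to the vector space of infinitesimal deformations of the transformed framework $T(\mathcal{F})$ takes the infinitesimal auxetic cone of $\mathcal{F}$ onto the infinitesimal auxetic cone of $T(\mathcal{F})$.
   Context: A $d$-periodic graph $(G,\Gamma)$ is a simple infinite graph $G=(V,E)$ with finite vertex degrees together with a free Abelian group $\Gamma\subset\mathrm{Aut}(G)$ of rank $d$ acting without fixed points on vertices and edges, with finitely many vertex and edge orbits. A periodic framework $(G,\Gamma,p,\pi)$ in $\mathbb{R}^d$ consists in addition of $p:V\to\mathbb{R}^d$ and an injective homomorphism $\pi$ from $\Gamma$ to the translations of $\mathbb{R}^d$ with $\pi(\Gamma)$ a lattice of rank $d$, such that $p(\gamma v)=\pi(\gamma)(p(v))$, and endpoints of edges have distinct images. Choose independent generators of $\Gamma$ and let $\Lambda$ be the $d\times d$ matrix whose columns are the translation vectors of their images under $\pi$. Let $p_i$, $i=1,\dots,n$, be the positions of a complete set of representatives for the vertex orbits. Every edge orbit has a representative joining $p_i$ to $p_j+\Lambda c$ for some $i,j$ and $c\in\mathbb{Z}^d$. An infinitesimal deformation of $\mathcal{F}$ is given by $(\dot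 p_i,\dot\Lambda)$ with $\dot p_i\in\mathbb{R}^d$, $i=1,\dots,n$, and $\dot\Lambda$ a $d\times d$ matrix, such that $\langle p_j+\Lambda c-p_i,\ \dot p_j+\dot\Lambda c-\dot p_i\rangle=0$ for every such edge representative. The infinitesimal auxetic cone of $\mathcal{F}$ is the set of infinitesimal deformations for which $\dot\Lambda^t\Lambda+\Lambda^t\dot\Lambda$ is positive semidefinite. The transformed framework $T(\mathcal{F})$ has the same periodic graph, vertex representatives at $T(p_i)$ and periodicity matrix $A\Lambda$ (with respect to the same generators of $\Gamma$). *)

theory Defs
  imports
    "HOL-Analysis.Analysis"
    "HOL-Algebra.Bij"
    "HOL-Algebra.Group_Action"
    "HOL-Algebra.Generated_Groups"
    "HOL-Algebra.Free_Abelian_Groups"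
begin

section \<open>Periodic graphs\<close>

definition simple_graph :: "'v set \<Rightarrow> 'v set set \<Rightarrow> bool" where
  "simple_graph V E \<longleftrightarrow> (\<forall>e\<in>E. e \<subseteq> V \<and> card e = 2)"

definition graph_automorphisms :: "'v set \<Rightarrow> 'v set set \<Rightarrow> ('v \<Rightarrow> 'v) set" where
  "graph_automorphisms V E = {f \<in> Bij V. \<forall>u\<in>V. \<forall>v\<in>V. {f u, f v} \<in> E \<longleftrightarrow> {u, v} \<in> E}"

definition period_group :: "'v set \<Rightarrow> ('v \<Rightarrow> 'v) set \<Rightarrow> ('v \<Rightarrow> 'v) monoid" where
  "period_group V \<Gamma> = (BijGroup V)\<lparr>carrier := \<Gamma>\<rparr>"

definition periodic_graph :: "nat \<Rightarrow> 'v set \<Rightarrow> 'v set set \<Rightarrow> ('v \<Rightarrow> 'v) set \<Rightarrow> bool" where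
  "periodic_graph d V E \<Gamma> \<longleftrightarrow>
     simple_graph V E \<and> infinite V \<and> (\<forall>v\<in>V. finite {e \<in> E. v \<in> e}) \<and>
     subgroup \<Gamma> (BijGroup V) \<and> \<Gamma> \<subseteq> graph_automorphisms V E \<and>
     period_group V \<Gamma> \<cong> free_Abelian_group {..<d} \<and>
     (\<forall>\<gamma>\<in>\<Gamma>. \<gamma> \<noteq> \<one>\<^bsub>BijGroup V\<^esub> \<longrightarrow> (\<forall>v\<in>V. \<gamma> v \<noteq> v) \<and> (\<forall>e\<in>E. \<gamma> ` e \<noteq> e)) \<and>
     finite (orbits (period_group V \<Gamma>) V (\<lambda>\<gamma> v. \<gamma> v)) \<and>
     finite (orbits (period_group V \<Gamma>) E (\<lambda>\<gamma> e. \<gamma> ` e))"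

section \<open>Periodic frameworks\<close>

definition translation_group :: "('a::real_vector \<Rightarrow> 'a) monoid" where
  "translation_group = (BijGroup UNIV)\<lparr>carrier := range (\<lambda>t x. x + t)\<rparr>"

definition translation_vector :: "('a::real_vector \<Rightarrow> 'a) \<Rightarrow> 'a" where
  "translation_vector f = f 0"

definition full_rank_lattice :: "(real ^ 'd) set \<Rightarrow> bool" where
  "full_rank_lattice L \<longleftrightarrow>
     (\<exists>b :: 'd::finite \<Rightarrow> real ^ 'd. inj b \<and> independent (range b) \<and>
        L = range (\<lambda>c :: 'd \<Rightarrow> int. \<Sum>k\<in>UNIV. of_int (c k) *\<^sub>R b k))"

record ('v, 'd) framework =
  verts :: "'v set"
  edges :: "'v set set"
  periods :: "('v \<Rightarrow> 'v) set"
  pos :: "'v \<Rightarrow> real ^ 'd"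
  per :: "('v \<Rightarrow> 'v) \<Rightarrow> real ^ 'd \<Rightarrow> real ^ 'd"

definition fw_group :: "('v, 'd::finite) framework \<Rightarrow> ('v \<Rightarrow> 'v) monoid" where
  "fw_group F = period_group (verts F) (periods F)"

definition periodic_framework :: "('v, 'd::finite) framework \<Rightarrow> bool" where
  "periodic_framework F \<longleftrightarrow>
     periodic_graph CARD('d) (verts F) (edges F) (periods F) \<and>
     per F \<in> hom (fw_group F) translation_group \<and>
     inj_on (per F) (periods F) \<and>
     full_rank_lattice ((\<lambda>\<gamma>. translation_vector (per F \<gamma>)) ` periods F) \<and>
     (\<forall>\<gamma>\<in>periods F. \<forall>v\<in>verts F. pos F (\<gamma> v) = per F \<gamma> (pos F v)) \<and>
     (\<forall>u v. {u, v} \<in> edges F \<longrightarrow> pos F u \<noteq> pos F v)"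

section \<open>Generators, vertex representatives, periodicity matrix\<close>

text \<open>The product of the \<open>k\<close>-th generators raised to the integer exponents \<open>c $ k\<close>.\<close>

definition period_of ::
  "('v, 'd::finite) framework \<Rightarrow> ('d \<Rightarrow> 'v \<Rightarrow> 'v) \<Rightarrow> int ^ 'd \<Rightarrow> 'v \<Rightarrow> 'v" where
  "period_of F g c = (\<Otimes>\<^bsub>fw_group F\<^esub>k\<in>UNIV. g k [^]\<^bsub>fw_group F\<^esub> (c $ k))"

definition independent_generators ::
  "('v, 'd::finite) framework \<Rightarrow> ('d \<Rightarrow> 'v \<Rightarrow> 'v) \<Rightarrow> bool" where
  "independent_generators F g \<longleftrightarrow>
     range g \<subseteq> periods F \<and>
     generate (fw_group F) (range g) = periods F \<and>
     (\<forall>c. period_of F g c = \<one>\<^bsub>fw_group F\<^esub> \<longrightarrow> c = 0)"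

text \<open>The index type \<open>'n\<close> enumerates the vertex orbits.\<close>

definition vertex_representatives ::
  "('v, 'd::finite) framework \<Rightarrow> ('n::finite \<Rightarrow> 'v) \<Rightarrow> bool" where
  "vertex_representatives F r \<longleftrightarrow>
     range r \<subseteq> verts F \<and>
     bij_betw (\<lambda>i. orbit (fw_group F) (\<lambda>\<gamma> v. \<gamma> v) (r i)) UNIV
       (orbits (fw_group F) (verts F) (\<lambda>\<gamma> v. \<gamma> v))"

definition periodicity_matrix ::
  "('v, 'd::finite) framework \<Rightarrow> ('d \<Rightarrow> 'v \<Rightarrow> 'v) \<Rightarrow> real ^ 'd ^ 'd" where
  "periodicity_matrix F g = (\<chi> i k. translation_vector (per F (g k)) $ i)"

definition real_vec :: "int ^ 'd::finite \<Rightarrow> real ^ 'd" where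
  "real_vec c = (\<chi> k. real_of_int (c $ k))"

section \<open>Infinitesimal deformations and the auxetic cone\<close>

text \<open>
  The triples \<open>(i, j, c)\<close> below run over all edges that join a chosen vertex representative
  to a translate of one; every edge orbit contains such an edge, and edges of the same orbit
  impose the same condition.
\<close>

definition infinitesimal_deformations ::
  "('v, 'd::finite) framework \<Rightarrow> ('d \<Rightarrow> 'v \<Rightarrow> 'v) \<Rightarrow> ('n::finite \<Rightarrow> 'v) \<Rightarrow>
    ((real ^ 'd ^ 'n) \<times> (real ^ 'd ^ 'd)) set" where
  "infinitesimal_deformations F g r =
     {(p', \<Lambda>'). \<forall>i j c. {r i, period_of F g c (r j)} \<in> edges F \<longrightarrow>
        (pos F (r j) + periodicity_matrix F g *v real_vec c - pos F (r i)) \<bullet>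
        (p' $ j + \<Lambda>' *v real_vec c - p' $ i) = 0}"

definition positive_semidefinite :: "real ^ 'd ^ 'd::finite \<Rightarrow> bool" where
  "positive_semidefinite M \<longleftrightarrow> transpose M = M \<and> (\<forall>x. 0 \<le> x \<bullet> (M *v x))"

definition infinitesimal_auxetic_cone ::
  "('v, 'd::finite) framework \<Rightarrow> ('d \<Rightarrow> 'v \<Rightarrow> 'v) \<Rightarrow> ('n::finite \<Rightarrow> 'v) \<Rightarrow>
    ((real ^ 'd ^ 'n) \<times> (real ^ 'd ^ 'd)) set" where
  "infinitesimal_auxetic_cone F g r =
     {(p', \<Lambda>') \<in> infinitesimal_deformations F g r.
        positive_semidefinite
          (transpose \<Lambda>' ** periodicity_matrix F g + transpose (periodicity_matrix F g) ** \<Lambda>')}"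

section \<open>Affine transformations of frameworks\<close>

definition affine_with_linear_part :: "(real ^ 'd \<Rightarrow> real ^ 'd) \<Rightarrow> real ^ 'd ^ 'd::finite \<Rightarrow> bool" where
  "affine_with_linear_part T A \<longleftrightarrow> (\<exists>b. \<forall>x. T x = A *v x + b)"

text \<open>
  \<open>A\<close> is meant to be the linear part of \<open>T\<close>: a period acting as the translation by \<open>t\<close> acts
  on the transformed framework as the translation by \<open>A *v t\<close>.
\<close>

definition transformed_framework ::
  "(real ^ 'd \<Rightarrow> real ^ 'd) \<Rightarrow> real ^ 'd ^ 'd \<Rightarrow> ('v, 'd::finite) framework \<Rightarrow> ('v, 'd) framework" where
  "transformed_framework T A F =
     F\<lparr>pos := \<lambda>v. T (pos F v),
       per := \<lambda>\<gamma> x. x + A *v translation_vector (per F \<gamma>)\<rparr>"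

lemma pos_transformed_framework:
  "pos (transformed_framework T A F) (r i) = T (pos F (r i))"
  by (simp add: transformed_framework_def)

lemma periodicity_matrix_transformed_framework:
  "periodicity_matrix (transformed_framework T A F) g = A ** periodicity_matrix F g"
  by (simp add: transformed_framework_def periodicity_matrix_def translation_vector_def
      matrix_matrix_mult_def matrix_vector_mult_def vec_eq_iff)

definition natural_map ::
  "real ^ 'd ^ 'd \<Rightarrow> (real ^ 'd ^ 'n) \<times> (real ^ 'd ^ 'd) \<Rightarrow>
    (real ^ 'd ^ 'n::finite) \<times> (real ^ 'd ^ 'd::finite)" where
  "natural_map A = (\<lambda>(p', \<Lambda>').
     (\<chi> i. matrix_inv (transpose A) *v (p' $ i), matrix_inv (transpose A) ** \<Lambda>'))"

end

theory Submission
  imports Defs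
begin

text \<open>
  Write \<open>B = (A\<^sup>t)\<^sup>-\<^sup>1\<close>. Then \<open>\<langle>A x, B y\<rangle> = \<langle>x, y\<rangle>\<close>, and \<open>B\<^sup>t A = I\<close>. An affine map \<open>T\<close> with linear
  part \<open>A\<close> sends an edge vector \<open>x\<close> of the framework to \<open>A x\<close>, while the natural map sends the
  corresponding velocity difference \<open>y\<close> to \<open>B y\<close>; so each edge equation of the transformed
  framework at the image of a deformation is literally the original edge equation
  (\<open>natural_map_mem_deformations_iff\<close>). In the same way
  \<open>(B \<Lambda>')\<^sup>t (A \<Lambda>) = \<Lambda>'\<^sup>t \<Lambda>\<close>, so the symmetric matrix whose semidefiniteness defines the
  auxetic cone does not change at all (\<open>natural_map_mem_auxetic_cone_iff\<close>). As \<open>B\<close> is invertible,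
  the natural map is a linear bijection of the ambient space, and a bijection that respects
  membership in both directions maps each of the two sets onto its counterpart.

  That \<open>T\<close> of the framework is again a periodic framework rests on the injectivity of \<open>A\<close>, which
  keeps the representation by translations faithful and the lattice of full rank
  (\<open>full_rank_lattice_image\<close>), and on the injectivity of \<open>T\<close>, which keeps edge endpoints apart.
\<close>

section \<open>The linear part and its contragredient\<close>

lemma affine_bij_imp_invertible:
  fixes A :: "real ^ 'd ^ 'd::finite"
  assumes "affine_with_linear_part T A" and "bij T"
  shows "invertible A"
proof -
  obtain b where T: "\<And>x. T x = A *v x + b"
    using assms(1) by (auto simp: affine_with_linear_part_def)
  have "inj ((*v) A)"
  proof (rule injI)
    fix x y assume "A *v x = A *v y"
    hence "T x = T y" by (simp add: T)
    thus "x = y" using assms(2) by (simp add: bij_def inj_eq)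
  qed
  thus ?thesis by (simp add: matrix_left_invertible_injective invertible_left_inverse)
qed

context
  fixes A :: "real ^ 'd ^ 'd::finite"
  assumes inv: "invertible A"
begin

lemma transpose_mult_contragredient: "transpose A ** matrix_inv (transpose A) = mat 1"
  and contragredient_mult_transpose: "matrix_inv (transpose A) ** transpose A = mat 1"
proof -
  have "\<exists>B. transpose A ** B = mat 1 \<and> B ** transpose A = mat 1"
    using transpose_invertible[OF inv] by (simp add: invertible_def)
  from someI_ex[OF this]
  show "transpose A ** matrix_inv (transpose A) = mat 1"
    "matrix_inv (transpose A) ** transpose A = mat 1"
    by (auto simp: matrix_inv_def)
qed

lemma transpose_contragredient_mult: "transpose (matrix_inv (transpose A)) ** A = mat 1"
  by (metis contragredient_mult_transpose matrix_transpose_mul transpose_mat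
      transpose_mult_contragredient transpose_transpose)

text \<open>
  The duality behind every edge equation: moving \<open>A\<close> to the other side of the inner product turns
  it into \<open>A\<^sup>t\<close>, which the contragredient cancels.
\<close>

lemma inner_contragredient: "(A *v x) \<bullet> (matrix_inv (transpose A) *v y) = x \<bullet> y"
proof -
  have "(A *v x) \<bullet> (matrix_inv (transpose A) *v y)
      = x \<bullet> (transpose A *v (matrix_inv (transpose A) *v y))"
    by (metis dot_lmul_matrix transpose_transpose vector_transpose_matrix)
  also have "\<dots> = x \<bullet> y"
    by (simp add: matrix_vector_mul_assoc transpose_mult_contragredient)
  finally show ?thesis .
qed

text \<open>
  This and its transposed companion make both summands of \<open>\<Lambda>'\<^sup>t \<Lambda> + \<Lambda>\<^sup>t \<Lambda>'\<close> invariant, and with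
  them the derivative of the Gram matrix \<open>\<Lambda>\<^sup>t \<Lambda>\<close> of the period lattice.
\<close>

lemma transpose_contragredient_mult_mult:
  "transpose (matrix_inv (transpose A) ** M) ** (A ** N) = transpose M ** N"
proof -
  have "transpose (matrix_inv (transpose A) ** M) ** (A ** N)
      = transpose M ** (transpose (matrix_inv (transpose A)) ** A) ** N"
    by (simp only: matrix_transpose_mul matrix_mul_assoc)
  thus ?thesis by (simp add: transpose_contragredient_mult)
qed

lemma transpose_mult_mult_contragredient:
  "transpose (A ** N) ** (matrix_inv (transpose A) ** M) = transpose N ** M"
proof -
  have "transpose (A ** N) ** (matrix_inv (transpose A) ** M)
      = transpose N ** (transpose A ** matrix_inv (transpose A)) ** M"
    by (simp only: matrix_transpose_mul matrix_mul_assoc)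
  thus ?thesis by (simp add: transpose_mult_contragredient)
qed

text \<open>Both components are inverted by left multiplication with \<open>A\<^sup>t\<close>.\<close>

lemma bij_natural_map:
  "bij (natural_map A :: (real ^ 'd ^ 'n::finite) \<times> (real ^ 'd ^ 'd) \<Rightarrow> _)"
proof (rule bijI')
  fix x y :: "(real ^ 'd ^ 'n) \<times> (real ^ 'd ^ 'd)"
  have *: "transpose A *v (matrix_inv (transpose A) *v v) = v"
    "transpose A ** (matrix_inv (transpose A) ** M) = M" for v M
    by (simp_all add: matrix_vector_mul_assoc matrix_mul_assoc transpose_mult_contragredient)
  show "natural_map A x = natural_map A y \<longleftrightarrow> x = y"
    by (cases x; cases y)
      (auto simp: natural_map_def vec_eq_iff[where 'a = "real ^ 'd" and 'b = 'n]; metis *)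
next
  fix y :: "(real ^ 'd ^ 'n) \<times> (real ^ 'd ^ 'd)"
  have "y = natural_map A (\<chi> i. transpose A *v (fst y $ i), transpose A ** snd y)"
    by (cases y) (simp add: natural_map_def matrix_vector_mul_assoc matrix_mul_assoc
        contragredient_mult_transpose del: transpose_matrix_vector)
  thus "\<exists>x. y = natural_map A x" by blast
qed

end

lemma linear_natural_map:
  "linear (natural_map A :: (real ^ 'd ^ 'n::finite) \<times> (real ^ 'd ^ 'd::finite) \<Rightarrow> _)"
proof (rule linearI)
  fix x y :: "(real ^ 'd ^ 'n) \<times> (real ^ 'd ^ 'd)" and a :: real
  show "natural_map A (x + y) = natural_map A x + natural_map A y"
    by (cases x; cases y)
      (simp add: natural_map_def plus_vec_def matrix_add_ldistrib[unfolded plus_vec_def]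
        matrix_vector_right_distrib[unfolded plus_vec_def])
  have "B ** (a *\<^sub>R M) = a *\<^sub>R (B ** M)" for B M :: "real ^ 'd ^ 'd"
    by (simp add: matrix_scalar_ac scalar_matrix_assoc)
  thus "natural_map A (a *\<^sub>R x) = a *\<^sub>R natural_map A x"
    by (cases x) (simp add: natural_map_def vec_eq_iff[where 'a = "real ^ 'd" and 'b = 'n] matrix_vector_mult_scaleR)
qed

section \<open>The transformed framework\<close>

lemma full_rank_lattice_image:
  fixes A :: "real ^ 'd ^ 'd::finite"
  assumes "invertible A" and "full_rank_lattice L"
  shows "full_rank_lattice ((*v) A ` L)"
proof -
  obtain b :: "'d \<Rightarrow> real ^ 'd" where b: "inj b" "independent (range b)"
    and L: "L = range (\<lambda>c :: 'd \<Rightarrow> int. \<Sum>k\<in>UNIV. of_int (c k) *\<^sub>R b k)"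
    using assms(2) unfolding full_rank_lattice_def by auto
  have injA: "inj ((*v) A)"
    using assms(1) by (simp add: inj_matrix_vector_mult)
  have "inj (\<lambda>k. A *v b k)"
    using b(1) injA by (simp add: inj_def)
  moreover have "independent (range (\<lambda>k. A *v b k))"
    using linear_independent_injective_image[OF matrix_vector_mul_linear b(2) inj_on_subset[OF injA]]
    by (simp add: image_image)
  moreover have "(*v) A ` L = range (\<lambda>c :: 'd \<Rightarrow> int. \<Sum>k\<in>UNIV. of_int (c k) *\<^sub>R (A *v b k))"
    by (simp add: L image_image linear_sum[OF matrix_vector_mul_linear] matrix_vector_mult_scaleR)
  ultimately show ?thesis unfolding full_rank_lattice_def by blast
qed

lemma translation_in_Bij: "(\<lambda>x. x + t) \<in> Bij (UNIV :: 'a::real_vector set)"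
proof -
  have "bij (\<lambda>x. x + t)"
    by (rule o_bij[of "\<lambda>x. x - t"]) auto
  thus ?thesis by (simp add: Bij_def)
qed

lemma mult_translation_group:
  "(\<lambda>x. x + s) \<otimes>\<^bsub>translation_group\<^esub> (\<lambda>x. x + t) = (\<lambda>x :: 'a::real_vector. x + (s + t))"
  by (simp add: translation_group_def BijGroup_def translation_in_Bij compose_def fun_eq_iff algebra_simps)

lemma carrier_translation_group_eq:
  "f \<in> carrier translation_group \<Longrightarrow> f = (\<lambda>x. x + translation_vector f)"
  by (auto simp: translation_group_def translation_vector_def)

lemma fw_group_transformed_framework: "fw_group (transformed_framework T A F) = fw_group F"
  by (simp add: fw_group_def transformed_framework_def)

lemma period_of_transformed_framework: "period_of (transformed_framework T A F) = period_of F"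
  by (intro ext) (simp add: period_of_def fw_group_transformed_framework)

lemma edges_transformed_framework: "edges (transformed_framework T A F) = edges F"
  by (simp add: transformed_framework_def)

text \<open>
  The underlying periodic graph is untouched, so only the placement and the representation by
  translations matter. The old representation is determined by the additive map \<open>t\<close> that sends a
  period to its translation vector; the new one belongs to \<open>A \<circ> t\<close>, which is again additive, and
  injective because \<open>A\<close> is. Equivariance is the identity \<open>T (x + t) = T x + A t\<close>.
\<close>

lemma periodic_framework_transformed:
  fixes F :: "('v, 'd::finite) framework"
  assumes F: "periodic_framework F" and T: "affine_with_linear_part T A" and "bij T"
  shows "periodic_framework (transformed_framework T A F)"
proof -
  obtain b where Tb: "\<And>x. T x = A *v x + b"
    using T by (auto simp: affine_with_linear_part_def)
  have inv: "invertible A" using affine_bij_imp_invertible T \<open>bij T\<close> by blast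
  have injT: "inj T" using \<open>bij T\<close> by (rule bij_is_inj)
  define F' where "F' = transformed_framework T A F"
  define t where "t = (\<lambda>\<gamma>. translation_vector (per F \<gamma>))"
  define G where "G = fw_group F"
  have [simp]: "carrier G = periods F"
    by (simp add: G_def fw_group_def period_group_def)
  have F'[simp]: "verts F' = verts F" "edges F' = edges F" "periods F' = periods F"
    "pos F' = (\<lambda>v. T (pos F v))" "per F' = (\<lambda>\<gamma> x. x + A *v t \<gamma>)" "fw_group F' = G"
    by (simp_all add: F'_def G_def t_def fw_group_transformed_framework,
        simp_all add: transformed_framework_def)
  have hom: "per F \<in> hom G translation_group"
    and injper: "inj_on (per F) (periods F)"
    and lat: "full_rank_lattice (t ` periods F)"
    and equiv: "\<And>\<gamma> v. \<gamma> \<in> periods F \<Longrightarrow> v \<in> verts F \<Longrightarrow> pos F (\<gamma> v) = per F \<gamma> (pos F v)"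
    and ends: "\<And>u v. {u, v} \<in> edges F \<Longrightarrow> pos F u \<noteq> pos F v"
    using F unfolding periodic_framework_def t_def G_def by auto
  have per: "per F \<gamma> = (\<lambda>x. x + t \<gamma>)" if "\<gamma> \<in> periods F" for \<gamma>
    using carrier_translation_group_eq[of "per F \<gamma>"] hom_in_carrier[OF hom] that
    by (simp add: t_def)
  have t_mult: "t (\<gamma> \<otimes>\<^bsub>G\<^esub> \<delta>) = t \<gamma> + t \<delta>" if "\<gamma> \<in> periods F" "\<delta> \<in> periods F" for \<gamma> \<delta>
  proof -
    have "per F (\<gamma> \<otimes>\<^bsub>G\<^esub> \<delta>) = per F \<gamma> \<otimes>\<^bsub>translation_group\<^esub> per F \<delta>"
      using hom_mult[OF hom] that by simp
    thus ?thesis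
      unfolding per[OF that(1)] per[OF that(2)] mult_translation_group
      by (simp add: t_def translation_vector_def)
  qed
  have "per F' \<in> hom G translation_group"
  proof (rule homI)
    show "per F' \<gamma> \<in> carrier translation_group" for \<gamma>
      by (simp add: translation_group_def)
    show "per F' (\<gamma> \<otimes>\<^bsub>G\<^esub> \<delta>) = per F' \<gamma> \<otimes>\<^bsub>translation_group\<^esub> per F' \<delta>"
      if "\<gamma> \<in> carrier G" "\<delta> \<in> carrier G" for \<gamma> \<delta>
      using that by (simp add: t_mult mult_translation_group matrix_vector_right_distrib)
  qed
  moreover have "inj_on (per F') (periods F)"
  proof (rule inj_onI)
    fix \<gamma> \<delta> assume *: "\<gamma> \<in> periods F" "\<delta> \<in> periods F" and "per F' \<gamma> = per F' \<delta>"
    hence "A *v t \<gamma> = A *v t \<delta>" by (metis F'(5) add_left_imp_eq)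
    hence "t \<gamma> = t \<delta>"
      using inj_matrix_vector_mult[OF inv] by (simp add: inj_eq)
    thus "\<gamma> = \<delta>" using injper per * by (metis inj_onD)
  qed
  moreover have "full_rank_lattice ((\<lambda>\<gamma>. translation_vector (per F' \<gamma>)) ` periods F)"
    using full_rank_lattice_image[OF inv lat] by (simp add: image_image translation_vector_def)
  moreover have "pos F' (\<gamma> v) = per F' \<gamma> (pos F' v)" if "\<gamma> \<in> periods F" "v \<in> verts F" for \<gamma> v
    using that by (simp add: equiv per Tb matrix_vector_right_distrib)
  moreover have "pos F' u \<noteq> pos F' v" if "{u, v} \<in> edges F" for u v
    using ends[OF that] injT by (simp add: inj_eq)
  moreover have "periodic_graph CARD('d) (verts F) (edges F) (periods F)"
    using F by (simp add: periodic_framework_def)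
  ultimately show ?thesis
    unfolding F'_def[symmetric] periodic_framework_def F'(1-3,6) by blast
qed

section \<open>Deformations and the auxetic cone\<close>

lemma subspace_infinitesimal_deformations:
  fixes F :: "('v, 'd::finite) framework"
  shows "subspace (infinitesimal_deformations F g r)"
proof (rule subspaceI)
  show "0 \<in> infinitesimal_deformations F g r"
    by (simp add: infinitesimal_deformations_def zero_prod_def)
next
  fix x y assume "x \<in> infinitesimal_deformations F g r" "y \<in> infinitesimal_deformations F g r"
  moreover have velocity_add: "(p + p') + (L + L') *v c - (q + q') = (p + L *v c - q) + (p' + L' *v c - q')"
    for p q p' q' c and L L' :: "real ^ 'd ^ 'd"
    by (simp add: matrix_vector_mult_add_rdistrib)
  ultimately show "x + y \<in> infinitesimal_deformations F g r"
    by (cases x; cases y)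
      (simp add: infinitesimal_deformations_def velocity_add inner_add_right)
next
  fix a x assume "x \<in> infinitesimal_deformations F g r"
  moreover have "a *\<^sub>R p + (a *\<^sub>R L) *v c - a *\<^sub>R q = a *\<^sub>R (p + L *v c - q)"
    for p q c :: "real ^ 'd" and L :: "real ^ 'd ^ 'd"
    by (simp add: scaleR_matrix_vector_assoc algebra_simps)
  ultimately show "a *\<^sub>R x \<in> infinitesimal_deformations F g r"
    by (cases x) (simp add: infinitesimal_deformations_def)
qed

text \<open>
  The translation part of \<open>T\<close> cancels in edge vectors, so these transform by \<open>A\<close> alone, while
  velocity differences transform by the contragredient.
\<close>

lemma natural_map_mem_deformations_iff:
  assumes "affine_with_linear_part T A" and inv: "invertible A"
  shows "natural_map A x \<in> infinitesimal_deformations (transformed_framework T A F) g r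
    \<longleftrightarrow> x \<in> infinitesimal_deformations F g r"
proof (cases x)
  case (Pair p' L')
  obtain b where T: "\<And>x. T x = A *v x + b"
    using assms(1) by (auto simp: affine_with_linear_part_def)
  let ?B = "matrix_inv (transpose A)"
  have edge: "T u + (A ** P) *v w - T v = A *v (u + P *v w - v)" for u v w P
    by (simp add: T matrix_vector_right_distrib matrix_vector_mult_diff_distrib
        matrix_vector_mul_assoc)
  have velocity: "?B *v u + (?B ** P) *v w - ?B *v v = ?B *v (u + P *v w - v)" for u v w P
    by (simp add: matrix_vector_right_distrib matrix_vector_mult_diff_distrib
        matrix_vector_mul_assoc)
  show ?thesis
    unfolding Pair
    by (simp add: infinitesimal_deformations_def natural_map_def edges_transformed_framework
        period_of_transformed_framework pos_transformed_framework
        periodicity_matrix_transformed_framework edge velocity inner_contragredient[OF inv])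
qed

lemma natural_map_mem_auxetic_cone_iff:
  assumes "affine_with_linear_part T A" and "invertible A"
  shows "natural_map A x \<in> infinitesimal_auxetic_cone (transformed_framework T A F) g r
    \<longleftrightarrow> x \<in> infinitesimal_auxetic_cone F g r"
proof (cases x)
  case (Pair p' L')
  show ?thesis
    using natural_map_mem_deformations_iff[OF assms, of x F g r] unfolding Pair
    by (simp add: infinitesimal_auxetic_cone_def natural_map_def
        periodicity_matrix_transformed_framework
        transpose_contragredient_mult_mult[OF assms(2)]
        transpose_mult_mult_contragredient[OF assms(2)])
qed

theorem mainTheorem7:
  fixes F :: "('v, 'd::finite) framework"
    and g :: "'d \<Rightarrow> 'v \<Rightarrow> 'v"
    and r :: "'n::finite \<Rightarrow> 'v"
    and T :: "real ^ 'd \<Rightarrow> real ^ 'd"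
    and A :: "real ^ 'd ^ 'd"
  assumes "periodic_framework F"
    and "independent_generators F g"
    and "vertex_representatives F r"
    and "affine_with_linear_part T A"
    and "bij T"
  shows "periodic_framework (transformed_framework T A F)
    \<and> subspace (infinitesimal_deformations F g r)
    \<and> subspace (infinitesimal_deformations (transformed_framework T A F) g r)
    \<and> linear (natural_map A :: (real ^ 'd ^ 'n) \<times> (real ^ 'd ^ 'd) \<Rightarrow> _)
    \<and> bij_betw (natural_map A) (infinitesimal_deformations F g r)
        (infinitesimal_deformations (transformed_framework T A F) g r)
    \<and> natural_map A ` infinitesimal_auxetic_cone F g r
        = infinitesimal_auxetic_cone (transformed_framework T A F) g r"
proof -
  have inv: "invertible A"
    using affine_bij_imp_invertible assms(4,5) by blast
  let ?N = "natural_map A :: (real ^ 'd ^ 'n) \<times> (real ^ 'd ^ 'd) \<Rightarrow> _"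
  have bij: "bij ?N" by (rule bij_natural_map[OF inv])
  \<comment> \<open>Surjectivity onto the whole ambient space turns an equivalence of memberships into an
    equality of images.\<close>
  have image: "?N ` S = S'" if "\<And>x. ?N x \<in> S' \<longleftrightarrow> x \<in> S" for S S'
  proof -
    have "S = ?N -` S'" using that by (simp add: set_eq_iff del: split_paired_All)
    thus ?thesis using bij_is_surj[OF bij] by (simp add: surj_image_vimage_eq)
  qed
  have "bij_betw ?N (infinitesimal_deformations F g r)
      (infinitesimal_deformations (transformed_framework T A F) g r)"
    by (rule bij_betw_subset[OF bij subset_UNIV
        image[OF natural_map_mem_deformations_iff[OF assms(4) inv]]])
  moreover have "?N ` infinitesimal_auxetic_cone F g r
      = infinitesimal_auxetic_cone (transformed_framework T A F) g r"
    by (rule image[OF natural_map_mem_auxetic_cone_iff[OF assms(4) inv]])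
  ultimately show ?thesis
    using periodic_framework_transformed[OF assms(1,4,5)] subspace_infinitesimal_deformations
      linear_natural_map by blast
qed

end
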